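(* Let $C,A_1,\dots,A_r\in\mathbb{S}^n$ and $b\in\mathbb{R}^r$, and consider the semidefinite program $$(\mathrm{SDP})\quad \min_{X\in\mathbb{S}^n}\ \langle C,X\rangle\quad\text{s.t. } \langle A_i,X\rangle=b_i\ \ \forall i\in[r],\quad X\succeq 0,$$ with dual $$(\mathrm{DSDP})\quad \max_{y\in\mathbb{R}^r}\ b^\top y\quad\text{s.t. } C-\sum_{i=1}^r y_iA_i\succeq 0,$$ both assumed strictly feasible. Suppose that the set $$\Gamma=\Big\{y\in\mathbb{R}^r:\ C-\sum_{i=1}^r y_iA_i\succeq 0\Big\}$$ is a polytope with extreme points $p_1,\dots,p_k$, and define $\mathcal{S}:=\bigcup_{j=1}^k\mathcal{E}(C-\mathcal{A}(p_j))$. Then the program $$(L_{\mathcal{S}})\quad \min_{X\in\mathbb{S}^n}\ \langle C,X\rangle\quad\text{s.t. } \langle A_i,X\rangle=b_i\ \ \forall i\in[r],\quad v^\top Xv\ge 0\ \ \forall v\in\mathcal{S}$$ is a linear program and solves (SDP), i.e. its optimal value equals the optimal value of (SDP).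
   Context: $\mathbb{S}^n$ is the set of real symmetric $n\times n$ matrices, $\langle A,B\rangle=\mathrm{tr}(AB)$ is the Frobenius inner product, $[r]=\{1,\dots,r\}$, and $X\succeq 0$ means $X$ is positive semidefinite. For $y\in\mathbb{R}^r$, $\mathcal{A}(y)=\sum_{i=1}^r y_iA_i$. For $A\in\mathbb{S}^n$, $\mathcal{E}(A)$ denotes an arbitrary orthonormal basis of $\mathbb{R}^n$ consisting of eigenvectors of $A$. Strict feasibility means: there is a positive definite $X$ with $\langle A_i,X\rangle=b_i$ for all $i$, and there is $y\in\mathbb{R}^r$ with $C-\mathcal{A}(y)$ positive definite. "Solving" an SDP with a linear program means that the linear program is a relaxation of the SDP whose optimal value equals that of the SDP. *)

theory Defs
  imports "HOL-Analysis.Analysis"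
begin

definition sym_matrices :: "(real^'n^'n) set" where
  "sym_matrices = {X. transpose X = X}"

definition frob_inner :: "real^'n^'n \<Rightarrow> real^'n^'n \<Rightarrow> real" where
  "frob_inner A B = trace (A ** B)"

definition pos_semidef :: "real^'n^'n \<Rightarrow> bool" where
  "pos_semidef X \<longleftrightarrow> X \<in> sym_matrices \<and> (\<forall>v. v \<bullet> (X *v v) \<ge> 0)"

definition pos_def :: "real^'n^'n \<Rightarrow> bool" where
  "pos_def X \<longleftrightarrow> X \<in> sym_matrices \<and> (\<forall>v. v \<noteq> 0 \<longrightarrow> v \<bullet> (X *v v) > 0)"

definition matrix_pencil :: "('r::finite \<Rightarrow> real^'n^'n) \<Rightarrow> real^'r \<Rightarrow> real^'n^'n" where
  "matrix_pencil A y = (\<Sum>i\<in>UNIV. (y $ i) *\<^sub>R A i)"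

(* Orthonormality and span B = UNIV together make B a basis, so independence and
   finiteness of B need not be listed; norm v = 1 makes every v nonzero, so M v = l v says
   that v is an eigenvector. *)
definition orthonormal_eigenbasis :: "real^'n^'n \<Rightarrow> (real^'n) set \<Rightarrow> bool" where
  "orthonormal_eigenbasis M B \<longleftrightarrow>
     pairwise orthogonal B \<and> (\<forall>v\<in>B. norm v = 1) \<and> span B = UNIV \<and>
     (\<forall>v\<in>B. \<exists>l. M *v v = l *\<^sub>R v)"

definition sdp_feasible ::
    "('r::finite \<Rightarrow> real^'n^'n) \<Rightarrow> real^'r \<Rightarrow> (real^'n^'n) set" where
  "sdp_feasible A b = {X \<in> sym_matrices. (\<forall>i. frob_inner (A i) X = b $ i) \<and> pos_semidef X}"

definition dsdp_feasible ::
    "real^'n^'n \<Rightarrow> ('r::finite \<Rightarrow> real^'n^'n) \<Rightarrow> (real^'r) set" where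
  "dsdp_feasible C A = {y. pos_semidef (C - matrix_pencil A y)}"

definition lp_feasible ::
    "('r::finite \<Rightarrow> real^'n^'n) \<Rightarrow> real^'r \<Rightarrow> (real^'n) set \<Rightarrow> (real^'n^'n) set" where
  "lp_feasible A b S =
     {X \<in> sym_matrices. (\<forall>i. frob_inner (A i) X = b $ i) \<and> (\<forall>v\<in>S. v \<bullet> (X *v v) \<ge> 0)}"

(* The program "optimise f over F", with variable ranging over the subspace V, is a linear
   program: linear objective and finitely many linear equality (Eqs) and inequality (Ineqs)
   constraints, each given by a linear functional and its right-hand side. *)
definition linear_program ::
    "'v::euclidean_space set \<Rightarrow> ('v \<Rightarrow> real) \<Rightarrow> 'v set \<Rightarrow> bool" where
  "linear_program V f F \<longleftrightarrow>
     subspace V \<and> linear f \<and>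
     (\<exists>Eqs Ineqs :: (('v \<Rightarrow> real) \<times> real) set.
        finite Eqs \<and> finite Ineqs \<and> (\<forall>(g, c) \<in> Eqs \<union> Ineqs. linear g) \<and>
        F = {X \<in> V. (\<forall>(g, c) \<in> Eqs. g X = c) \<and> (\<forall>(g, c) \<in> Ineqs. g X \<ge> c)})"

(* Extended-real valued: infinity for an infeasible program, - infinity for an unbounded one. *)
definition min_value :: "('v \<Rightarrow> real) \<Rightarrow> 'v set \<Rightarrow> ereal" where
  "min_value f F = (INF X\<in>F. ereal (f X))"

(* G defines a relaxation, with the same objective, of minimising f over F, and the two
   optimal values agree. *)
definition solves_min :: "('v \<Rightarrow> real) \<Rightarrow> 'v set \<Rightarrow> 'v set \<Rightarrow> bool" where
  "solves_min f G F \<longleftrightarrow> F \<subseteq> G \<and> min_value f G = min_value f F"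

end

theory Submission
  imports Defs
begin

text \<open>
  Every \<open>X\<close> feasible for the linear program satisfies \<open>\<langle>C, X\<rangle> \<ge> b \<bullet> y\<close> for all
  dual feasible \<open>y\<close>, although \<open>X\<close> need not be positive semidefinite. At an extreme point \<open>q\<close> of the
  dual polytope, \<open>\<langle>C, X\<rangle> - b \<bullet> q = \<langle>C - \<A>(q), X\<rangle>\<close>, and computing this trace in the chosen
  eigenbasis of \<open>C - \<A>(q)\<close> gives \<open>\<Sum>v. \<lambda>\<^sub>v (v \<bullet> X v)\<close>, where \<open>\<lambda>\<^sub>v \<ge> 0\<close> because \<open>q\<close> is dual feasible and
  \<open>v \<bullet> X v \<ge> 0\<close> is exactly a constraint of the linear program. The inequality is affine in \<open>y\<close>, so it
  passes from the extreme points to their convex hull, which is the whole polytope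
  (\<open>weak_duality_polyhedral\<close>).

  Conversely, every real lower bound \<open>v\<close> of the semidefinite program is matched by a dual feasible
  \<open>y\<close> with \<open>v \<le> b \<bullet> y\<close> (\<open>strong_duality_bounded_dual\<close>). This is a separation argument; boundedness of
  the dual feasible set excludes a vertical separating hyperplane.

  Chaining the two facts, a lower bound of the semidefinite program is also a lower bound of the
  linear program. As the latter is a relaxation, the two values agree.
\<close>

section \<open>The Frobenius pairing\<close>

lemma frob_inner_entries: "frob_inner M X = (\<Sum>i\<in>UNIV. \<Sum>j\<in>UNIV. M $ i $ j * X $ j $ i)"
  by (simp add: frob_inner_def trace_def matrix_matrix_mult_def)

lemma frob_inner_commute: "frob_inner M X = frob_inner X M"
  unfolding frob_inner_def by (rule trace_mul_sym)

lemma linear_frob_inner: "linear (frob_inner M)"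
  by (rule linearI)
     (simp_all add: frob_inner_entries algebra_simps sum.distrib sum_distrib_left)

lemma linear_frob_inner_left: "linear (\<lambda>M. frob_inner M X)"
proof -
  have "(\<lambda>M. frob_inner M X) = frob_inner X"
    by (rule ext) (rule frob_inner_commute)
  then show ?thesis by (simp add: linear_frob_inner)
qed

lemma frob_inner_matrix_pencil:
  "frob_inner (matrix_pencil A y) X = y \<bullet> (\<chi> i. frob_inner (A i) X)"
  by (simp add: matrix_pencil_def linear_sum[OF linear_frob_inner_left]
      linear_cmul[OF linear_frob_inner_left] inner_vec_def)

text \<open>
  The rank-one matrix \<open>w w\<^sup>T\<close>. Pairing with it evaluates a quadratic form, which makes
  \<open>X \<mapsto> w \<bullet> X w\<close> a linear functional and turns statements about the pairing with all positive
  semidefinite matrices into statements about quadratic forms.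
\<close>

definition outer_square :: "real^'n \<Rightarrow> real^'n^'n" where
  "outer_square w = (\<chi> i j. w $ i * w $ j)"

lemma frob_inner_outer_square: "frob_inner M (outer_square w) = w \<bullet> (M *v w)"
  by (simp add: frob_inner_entries outer_square_def inner_vec_def matrix_vector_mult_def
      sum_distrib_left mult_ac)

section \<open>Symmetric and positive semidefinite matrices\<close>

lemma subspace_sym_matrices: "subspace sym_matrices"
  by (auto simp: subspace_def sym_matrices_def transpose_def vec_eq_iff)

lemma matrix_pencil_sym:
  assumes "\<forall>i. A i \<in> sym_matrices"
  shows "matrix_pencil A y \<in> sym_matrices"
  unfolding matrix_pencil_def
  using assms by (intro subspace_sum subspace_scale subspace_sym_matrices) auto

lemma linear_matrix_pencil: "linear (matrix_pencil A)"
  by (rule linearI)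
     (simp_all add: matrix_pencil_def scaleR_left_distrib sum.distrib scaleR_right.sum)

lemma linear_quadratic_form: "linear (\<lambda>X :: real^'n^'n. v \<bullet> (X *v v))"
  unfolding frob_inner_outer_square[symmetric] by (rule linear_frob_inner_left)

lemma pos_semidef_add:
  assumes "pos_semidef M" "pos_semidef N"
  shows "pos_semidef (M + N)"
  using assms subspace_add[OF subspace_sym_matrices]
  by (auto simp: pos_semidef_def matrix_vector_mult_add_rdistrib inner_add_right)

lemma pos_semidef_scaleR:
  assumes "0 \<le> c" "pos_semidef M"
  shows "pos_semidef (c *\<^sub>R M)"
  using assms subspace_scale[OF subspace_sym_matrices]
  by (auto simp: pos_semidef_def linear_cmul[OF linear_quadratic_form])

lemma pos_semidef_zero: "pos_semidef 0"
  using subspace_0[OF subspace_sym_matrices] by (simp add: pos_semidef_def)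

lemma pos_def_imp_pos_semidef:
  assumes "pos_def M"
  shows "pos_semidef M"
  unfolding pos_semidef_def
proof (intro conjI allI)
  show "M \<in> sym_matrices" using assms by (simp add: pos_def_def)
  show "0 \<le> v \<bullet> (M *v v)" for v
    using assms by (cases "v = 0") (auto simp: pos_def_def intro: less_imp_le)
qed

lemma convex_pos_semidef: "convex {X. pos_semidef X}"
  by (auto simp: convex_def intro!: pos_semidef_add pos_semidef_scaleR)

lemma pos_semidef_outer_square: "pos_semidef (outer_square w)"
proof -
  have "v \<bullet> (outer_square w *v v) = (v \<bullet> w)\<^sup>2" for v
    by (simp add: outer_square_def inner_vec_def matrix_vector_mult_def power2_eq_square
        sum_product sum_distrib_left mult_ac)
  then show ?thesis
    by (simp add: pos_semidef_def sym_matrices_def outer_square_def transpose_def vec_eq_iff mult_ac)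
qed

text \<open>
  A linear functional bounded below on a cone is nonnegative there: a negative value could be scaled
  beyond any bound. On rank-one matrices this is the definition of semidefiniteness, so this is
  the half of the self-duality of the semidefinite cone that separation arguments need.
\<close>

lemma pos_semidef_if_frob_inner_bounded_below:
  assumes "M \<in> sym_matrices"
    and bound: "\<And>X. pos_semidef X \<Longrightarrow> \<beta> \<le> frob_inner M X"
  shows "pos_semidef M"
proof -
  have "0 \<le> w \<bullet> (M *v w)" for w
  proof (rule ccontr)
    define q where "q = w \<bullet> (M *v w)"
    assume "\<not> 0 \<le> w \<bullet> (M *v w)"
    then have "q < 0" by (simp add: q_def)
    \<comment> \<open>This scaling makes the pairing equal to \<open>- (\<bar>\<beta>\<bar> + 1)\<close>, which is below \<open>\<beta>\<close>.\<close>
    define s where "s = (\<bar>\<beta>\<bar> + 1) / - q"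
    have "0 \<le> s" using \<open>q < 0\<close> by (simp add: s_def divide_simps)
    then have "\<beta> \<le> frob_inner M (s *\<^sub>R outer_square w)"
      by (intro bound pos_semidef_scaleR pos_semidef_outer_square)
    also have "\<dots> = s * q"
      by (simp add: linear_cmul[OF linear_frob_inner] frob_inner_outer_square q_def)
    also have "\<dots> = - (\<bar>\<beta>\<bar> + 1)" using \<open>q < 0\<close> by (simp add: s_def divide_simps)
    finally show False by simp
  qed
  with assms(1) show ?thesis by (simp add: pos_semidef_def)
qed

section \<open>Orthonormal eigenbases\<close>

lemma orthonormal_eigenbasis_finite:
  assumes "orthonormal_eigenbasis M B"
  shows "finite B"
proof -
  have "0 \<notin> B" using assms by (auto simp: orthonormal_eigenbasis_def)
  then show ?thesis
    using assms pairwise_orthogonal_independent independent_imp_finite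
    by (auto simp: orthonormal_eigenbasis_def)
qed

text \<open>
  The trace does not depend on the orthonormal basis in which it is computed. Expanding each
  column of \<open>N\<close> in the basis \<open>B\<close> and exchanging the sums over \<open>B\<close> and over coordinates gives the formula.
\<close>

lemma trace_orthonormal_basis:
  fixes N :: "real^'n^'n"
  assumes "finite B" "pairwise orthogonal B" "\<And>v. v \<in> B \<Longrightarrow> norm v = 1" "span B = UNIV"
  shows "trace N = (\<Sum>v\<in>B. v \<bullet> (N *v v))"
proof -
  have diag: "N $ i $ i = (\<Sum>v\<in>B. v $ i * (\<Sum>j\<in>UNIV. N $ j $ i * v $ j))" for i
  proof -
    have "(\<Sum>v\<in>B. (column i N \<bullet> v) *\<^sub>R v) = column i N"
      using assms by (intro orthonormal_basis_expand) auto
    then have "N $ i $ i = (\<Sum>v\<in>B. (column i N \<bullet> v) *\<^sub>R v) $ i"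
      by (simp add: column_def)
    then show ?thesis by (simp add: inner_vec_def column_def mult_ac)
  qed
  have "trace N = (\<Sum>v\<in>B. \<Sum>i\<in>UNIV. \<Sum>j\<in>UNIV. v $ i * (N $ j $ i * v $ j))"
    unfolding trace_def by (subst diag, subst sum.swap) (simp add: sum_distrib_left)
  also have "\<dots> = (\<Sum>v\<in>B. v \<bullet> (N *v v))"
    by (intro sum.cong refl, subst sum.swap)
       (simp add: inner_vec_def matrix_vector_mult_def sum_distrib_left mult_ac)
  finally show ?thesis .
qed

text \<open>
  In an eigenbasis of \<open>M\<close> the pairing is \<open>\<Sum>v. \<lambda>\<^sub>v (v \<bullet> X v)\<close> with eigenvalues \<open>\<lambda>\<^sub>v \<ge> 0\<close>. Hence
  semidefiniteness of \<open>X\<close> has to be tested on the finitely many basis vectors only; this is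
  why finitely many linear constraints can replace the semidefinite one.
\<close>

lemma frob_inner_nonneg_on_eigenbasis:
  assumes basis: "orthonormal_eigenbasis M B"
    and psd: "pos_semidef M"
    and X: "\<And>v. v \<in> B \<Longrightarrow> 0 \<le> v \<bullet> (X *v v)"
  shows "0 \<le> frob_inner M X"
proof -
  \<comment> \<open>In the order \<open>X ** M\<close> the factor \<open>M\<close> acts on the eigenvector first.\<close>
  have "frob_inner M X = (\<Sum>v\<in>B. v \<bullet> ((X ** M) *v v))"
    unfolding frob_inner_def
    by (subst trace_mul_sym, rule trace_orthonormal_basis)
       (use basis orthonormal_eigenbasis_finite in \<open>auto simp: orthonormal_eigenbasis_def\<close>)
  also have "0 \<le> \<dots>"
  proof (rule sum_nonneg)
    fix v assume "v \<in> B"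
    then obtain l where l: "M *v v = l *\<^sub>R v" and "norm v = 1"
      using basis unfolding orthonormal_eigenbasis_def by blast
    have "v \<bullet> (M *v v) = l"
      using \<open>norm v = 1\<close> by (simp add: l dot_square_norm)
    then have "0 \<le> l" using psd by (metis pos_semidef_def)
    have "v \<bullet> ((X ** M) *v v) = l * (v \<bullet> (X *v v))"
      by (simp add: l matrix_vector_mul_assoc[symmetric] matrix_vector_mult_scaleR)
    then show "0 \<le> v \<bullet> ((X ** M) *v v)"
      using \<open>0 \<le> l\<close> X[OF \<open>v \<in> B\<close>] by simp
  qed
  finally show ?thesis .
qed

section \<open>Duality\<close>

text \<open>
  The eigenbases give the inequality at the extreme points. For fixed \<open>X\<close> the set of \<open>y\<close>
  satisfying it is a half-space, so it contains the convex hull of the extreme points as well,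
  which is all of the dual polytope by the Krein-Milman theorem.
\<close>

lemma weak_duality_polyhedral:
  assumes polytope: "polytope (dsdp_feasible C A)"
    and vertex: "\<And>q. q extreme_point_of dsdp_feasible C A \<Longrightarrow>
      \<exists>B\<subseteq>S. orthonormal_eigenbasis (C - matrix_pencil A q) B"
    and X: "X \<in> lp_feasible A b S"
    and y: "y \<in> dsdp_feasible C A"
  shows "b \<bullet> y \<le> frob_inner C X"
proof -
  have "{q. q extreme_point_of dsdp_feasible C A} \<subseteq> {q. b \<bullet> q \<le> frob_inner C X}"
  proof clarify
    fix q assume q: "q extreme_point_of dsdp_feasible C A"
    then obtain B where "B \<subseteq> S" "orthonormal_eigenbasis (C - matrix_pencil A q) B"
      using vertex by blast
    moreover have "pos_semidef (C - matrix_pencil A q)"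
      using q by (auto simp: extreme_point_of_def dsdp_feasible_def)
    ultimately have "0 \<le> frob_inner (C - matrix_pencil A q) X"
      using X by (intro frob_inner_nonneg_on_eigenbasis) (auto simp: lp_feasible_def)
    also have "\<dots> = frob_inner C X - q \<bullet> (\<chi> i. frob_inner (A i) X)"
      by (simp add: linear_diff[OF linear_frob_inner_left] frob_inner_matrix_pencil)
    also have "(\<chi> i. frob_inner (A i) X) = b"
      using X by (simp add: lp_feasible_def vec_eq_iff)
    finally show "b \<bullet> q \<le> frob_inner C X" by (simp add: inner_commute)
  qed
  then have "convex hull {q. q extreme_point_of dsdp_feasible C A} \<subseteq> {q. b \<bullet> q \<le> frob_inner C X}"
    by (rule hull_minimal) (rule convex_halfspace_le)
  with y Krein_Milman_Minkowski[OF polytope_imp_compact[OF polytope] polytope_imp_convex[OF polytope]]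
  show ?thesis by auto
qed

text \<open>
  If \<open>\<A>(z)\<close> is positive semidefinite, then moving from a dual feasible point in direction \<open>- z\<close>
  only adds positive semidefinite matrices to the slack, so the whole ray stays feasible. A bounded
  feasible set contains no ray.
\<close>

lemma recession_direction_zero:
  assumes "bounded (dsdp_feasible C A)" "y \<in> dsdp_feasible C A" "pos_semidef (matrix_pencil A z)"
  shows "z = 0"
proof (rule ccontr)
  assume "z \<noteq> 0"
  have ray: "y - s *\<^sub>R z \<in> dsdp_feasible C A" if "0 \<le> s" for s
  proof -
    have "C - matrix_pencil A (y - s *\<^sub>R z) = (C - matrix_pencil A y) + s *\<^sub>R matrix_pencil A z"
      by (simp add: linear_diff[OF linear_matrix_pencil] linear_cmul[OF linear_matrix_pencil])
    moreover have "pos_semidef \<dots>"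
      using assms that by (auto simp: dsdp_feasible_def intro!: pos_semidef_add pos_semidef_scaleR)
    ultimately show ?thesis by (simp only: dsdp_feasible_def mem_Collect_eq)
  qed
  obtain K where K: "\<And>x. x \<in> dsdp_feasible C A \<Longrightarrow> norm x \<le> K"
    using assms(1) by (auto simp: bounded_iff)
  \<comment> \<open>Far enough along the ray for the triangle inequality to leave the ball of radius \<open>K\<close>.\<close>
  define s where "s = (norm y + \<bar>K\<bar> + 1) / norm z"
  have "norm (s *\<^sub>R z) = norm y + \<bar>K\<bar> + 1"
    using \<open>z \<noteq> 0\<close> by (simp add: s_def)
  moreover have "norm (s *\<^sub>R z) \<le> norm y + norm (y - s *\<^sub>R z)"
    using norm_triangle_ineq4[of y "y - s *\<^sub>R z"] by simp
  moreover have "norm (y - s *\<^sub>R z) \<le> K"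
    by (intro K ray) (simp add: s_def)
  ultimately show False by linarith
qed

text \<open>
  The map \<open>X \<mapsto> (\<A>\<^sup>*(X), \<langle>C, X\<rangle>)\<close> sends the positive semidefinite cone to a convex set. Since \<open>v\<close>
  is a lower bound, this set misses the ray \<open>{b} \<times> (-\<infinity>, v)\<close>. A separating hyperplane with normal
  \<open>(z, \<mu>)\<close> makes \<open>\<A>(z) + \<mu> C\<close> positive semidefinite and has \<open>\<mu> \<ge> 0\<close>. If \<open>\<mu> > 0\<close>, then \<open>y = - z / \<mu>\<close> is
  the required multiplier. If \<open>\<mu> = 0\<close>, then \<open>z\<close> gives a recession direction of the dual feasible set,
  hence \<open>z = 0\<close>, and the normal would vanish.
\<close>

lemma strong_duality_bounded_dual:
  assumes C: "C \<in> sym_matrices" and A: "\<forall>i. A i \<in> sym_matrices"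
    and bounded: "bounded (dsdp_feasible C A)" and y0: "y0 \<in> dsdp_feasible C A"
    and lower: "\<And>X. X \<in> sdp_feasible A b \<Longrightarrow> v \<le> frob_inner C X"
  shows "\<exists>y\<in>dsdp_feasible C A. v \<le> b \<bullet> y"
proof -
  define value_map where "value_map X = ((\<chi> i. frob_inner (A i) X) :: real^_, frob_inner C X)" for X
  have "linear value_map"
    by (rule linearI)
       (simp_all add: value_map_def linear_add[OF linear_frob_inner] linear_cmul[OF linear_frob_inner]
          vec_eq_iff)
  then have convex: "convex (value_map ` {X. pos_semidef X})"
    by (intro convex_linear_image convex_pos_semidef)
  have "convex ({b} \<times> {..<v})"
    by (intro convex_Times) auto
  moreover have "({b} \<times> {..<v}) \<inter> value_map ` {X. pos_semidef X} = {}"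
  proof (rule ccontr)
    assume "({b} \<times> {..<v}) \<inter> value_map ` {X. pos_semidef X} \<noteq> {}"
    then obtain X where "pos_semidef X" "(\<chi> i. frob_inner (A i) X) = b" "frob_inner C X < v"
      by (auto simp: value_map_def)
    then have "X \<in> sdp_feasible A b"
      by (auto simp: sdp_feasible_def pos_semidef_def)
    with lower \<open>frob_inner C X < v\<close> show False by force
  qed
  moreover have "{b} \<times> {..<v} \<noteq> {}"
    using lt_ex[of v] by auto
  moreover have "value_map ` {X. pos_semidef X} \<noteq> {}"
    using pos_semidef_zero by auto
  ultimately obtain a \<beta> where "a \<noteq> 0"
    and below: "\<forall>x\<in>{b} \<times> {..<v}. a \<bullet> x \<le> \<beta>"
    and above: "\<forall>x\<in>value_map ` {X. pos_semidef X}. \<beta> \<le> a \<bullet> x"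
    using separating_hyperplane_sets[OF _ convex] by metis
  obtain z \<mu> where a: "a = (z, \<mu>)" by (cases a)
  define N where "N = matrix_pencil A z + \<mu> *\<^sub>R C"
  have N_bound: "\<beta> \<le> frob_inner N X" if "pos_semidef X" for X
    using above that
    by (auto simp: a value_map_def N_def linear_add[OF linear_frob_inner_left] linear_cmul[OF linear_frob_inner_left]
        frob_inner_matrix_pencil)
  have "N \<in> sym_matrices"
    unfolding N_def using A C
    by (intro subspace_add subspace_scale subspace_sym_matrices matrix_pencil_sym) auto
  then have N: "pos_semidef N"
    using N_bound by (rule pos_semidef_if_frob_inner_bounded_below)
  have "\<beta> \<le> 0"
    using N_bound[OF pos_semidef_zero] by (simp add: linear_0[OF linear_frob_inner])
  then have t_bound: "z \<bullet> b + \<mu> * t \<le> 0" if "t < v" for t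
    using below that by (force simp: a)
  have "0 \<le> \<mu>"
  proof (rule ccontr)
    assume "\<not> 0 \<le> \<mu>"
    \<comment> \<open>Going down the ray with \<open>\<mu> < 0\<close> makes \<open>\<mu> * t\<close> outgrow \<open>\<bar>z \<bullet> b\<bar>\<close>; the minimum keeps \<open>t\<close> below \<open>v\<close>.\<close>
    define t where "t = min (v - 1) ((\<bar>z \<bullet> b\<bar> + 1) / \<mu>)"
    have "\<mu> * ((\<bar>z \<bullet> b\<bar> + 1) / \<mu>) \<le> \<mu> * t"
      using \<open>\<not> 0 \<le> \<mu>\<close> by (intro mult_left_mono_neg) (auto simp: t_def)
    then have "\<bar>z \<bullet> b\<bar> + 1 \<le> \<mu> * t"
      using \<open>\<not> 0 \<le> \<mu>\<close> by simp
    moreover have "z \<bullet> b + \<mu> * t \<le> 0"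
      by (rule t_bound) (simp add: t_def)
    ultimately show False by linarith
  qed
  moreover have "\<mu> \<noteq> 0"
  proof
    assume "\<mu> = 0"
    then have "z = 0"
      using N by (intro recession_direction_zero[OF bounded y0]) (simp add: N_def)
    with \<open>\<mu> = 0\<close> \<open>a \<noteq> 0\<close> show False by (simp add: a zero_prod_def)
  qed
  ultimately have "0 < \<mu>" by simp
  define y where "y = (- inverse \<mu>) *\<^sub>R z"
  have "C - matrix_pencil A y = inverse \<mu> *\<^sub>R N"
    using \<open>0 < \<mu>\<close>
    by (simp add: y_def N_def linear_cmul[OF linear_matrix_pencil] linear_neg[OF linear_matrix_pencil]
        scaleR_right_distrib)
  then have "y \<in> dsdp_feasible C A"
    using N \<open>0 < \<mu>\<close> by (simp add: dsdp_feasible_def pos_semidef_scaleR)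
  moreover have "v \<le> b \<bullet> y"
  proof (rule dense_le)
    fix t assume "t < v"
    then show "t \<le> b \<bullet> y"
      using t_bound[of t] \<open>0 < \<mu>\<close> by (simp add: y_def inner_commute field_simps)
  qed
  ultimately show ?thesis by blast
qed

section \<open>The linear program\<close>

lemma linear_program_lp_feasible:
  fixes A :: "'r::finite \<Rightarrow> real^'n^'n"
  assumes "finite S"
  shows "linear_program sym_matrices (frob_inner C) (lp_feasible A b S)"
  unfolding linear_program_def
proof (intro conjI exI)
  let ?Eqs = "(\<lambda>i. (frob_inner (A i), b $ i)) ` UNIV"
  let ?Ineqs = "(\<lambda>v. (\<lambda>X :: real^'n^'n. v \<bullet> (X *v v), 0 :: real)) ` S"
  show "finite ?Eqs" "finite ?Ineqs" using assms by auto
  show "\<forall>(g, c)\<in>?Eqs \<union> ?Ineqs. linear g"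
    by (auto simp: linear_frob_inner linear_quadratic_form)
  show "lp_feasible A b S =
      {X \<in> sym_matrices. (\<forall>(g, c)\<in>?Eqs. g X = c) \<and> (\<forall>(g, c)\<in>?Ineqs. c \<le> g X)}"
    by (auto simp: lp_feasible_def)
qed (rule subspace_sym_matrices linear_frob_inner)+

theorem theorem1:
  fixes C :: "real^'n^'n"
    and A :: "'r::finite \<Rightarrow> real^'n^'n"
    and b :: "real^'r"
    and k :: nat
    and p :: "nat \<Rightarrow> real^'r"
    and E :: "real^'n^'n \<Rightarrow> (real^'n) set"
    and S :: "(real^'n) set"
  assumes "C \<in> sym_matrices"
    and "\<forall>i. A i \<in> sym_matrices"
    and primal_strict: "\<exists>X. pos_def X \<and> (\<forall>i. frob_inner (A i) X = b $ i)"
    and dual_strict: "\<exists>y. pos_def (C - matrix_pencil A y)"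
    and "polytope (dsdp_feasible C A)"
    and "p ` {1..k} = {y. y extreme_point_of (dsdp_feasible C A)}"
    and "\<forall>j\<in>{1..k}. orthonormal_eigenbasis (C - matrix_pencil A (p j))
                                  (E (C - matrix_pencil A (p j)))"
    and S_def: "S = (\<Union>j\<in>{1..k}. E (C - matrix_pencil A (p j)))"
  shows "linear_program sym_matrices (frob_inner C) (lp_feasible A b S)
       \<and> solves_min (frob_inner C) (lp_feasible A b S) (sdp_feasible A b)"
proof
  have "finite S"
    unfolding S_def using assms(7) orthonormal_eigenbasis_finite by blast
  then show "linear_program sym_matrices (frob_inner C) (lp_feasible A b S)"
    by (rule linear_program_lp_feasible)
  have relaxation: "sdp_feasible A b \<subseteq> lp_feasible A b S"
    by (auto simp: sdp_feasible_def lp_feasible_def pos_semidef_def)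
  have vertex: "\<exists>B\<subseteq>S. orthonormal_eigenbasis (C - matrix_pencil A q) B"
    if "q extreme_point_of dsdp_feasible C A" for q
  proof -
    have "q \<in> p ` {1..k}" using that assms(6) by simp
    then obtain j where j: "j \<in> {1..k}" "q = p j" by blast
    show ?thesis
    proof (intro exI conjI)
      show "E (C - matrix_pencil A q) \<subseteq> S" unfolding S_def using j by (intro subsetI UN_I) auto
      show "orthonormal_eigenbasis (C - matrix_pencil A q) (E (C - matrix_pencil A q))"
        using assms(7) j by simp
    qed
  qed
  obtain y0 where "pos_def (C - matrix_pencil A y0)" using dual_strict by blast
  then have y0: "y0 \<in> dsdp_feasible C A"
    by (simp add: dsdp_feasible_def pos_def_imp_pos_semidef)
  have "min_value (frob_inner C) (sdp_feasible A b) \<le> ereal (frob_inner C X)"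
    if X: "X \<in> lp_feasible A b S" for X
  proof (rule ccontr)
    assume "\<not> ?thesis"
    \<comment> \<open>A real number strictly in between also covers the case where the semidefinite value is infinite.\<close>
    then obtain v where v: "frob_inner C X < v"
      and "ereal v < min_value (frob_inner C) (sdp_feasible A b)"
      using ereal_dense2[of "ereal (frob_inner C X)"] by (auto simp: not_le)
    then have "v \<le> frob_inner C Z" if "Z \<in> sdp_feasible A b" for Z
      using INF_lower[OF that, of "\<lambda>Z. ereal (frob_inner C Z)"] unfolding min_value_def
      by (metis ereal_less_eq(3) less_le_trans less_imp_le)
    then obtain y where "y \<in> dsdp_feasible C A" "v \<le> b \<bullet> y"
      using strong_duality_bounded_dual[OF assms(1,2) polytope_imp_bounded[OF assms(5)] y0]
      by blast
    then show False
      using weak_duality_polyhedral[OF assms(5) vertex X] v by fastforce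
  qed
  then have "min_value (frob_inner C) (sdp_feasible A b)
      \<le> min_value (frob_inner C) (lp_feasible A b S)"
    unfolding min_value_def[of _ "lp_feasible A b S"] by (rule INF_greatest)
  moreover have "min_value (frob_inner C) (lp_feasible A b S)
      \<le> min_value (frob_inner C) (sdp_feasible A b)"
    unfolding min_value_def using relaxation by (rule INF_superset_mono) simp
  ultimately show "solves_min (frob_inner C) (lp_feasible A b S) (sdp_feasible A b)"
    unfolding solves_min_def using relaxation by (simp add: antisym)
qed

end
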